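(* For the battery charging game with $T=2$ time steps and any price profile $\mathbf{p}\in\mathbb{R}^2$, the price of anarchy satisfies $\mathrm{PoA}_{\mathbf{p}}\ge 2$, where $\mathrm{PoA}_{\mathbf{p}}$ denotes the price of anarchy for the class $P=\{\mathbf{p}\}$.
   Context: **Battery charging game.** An instance consists of: a number of time steps $T\in\mathbb{N}$, with $[T]=\{1,\dots,T\}$; a finite directed graph $H=(V,E)$; for each $t\in[T]$ a copy $H_t=(V_t,E_t)$ of $H$ (the copy of $v\in V$ is $v_t$); a capacity $\kappa(e_t)\ge 0$ for each $e_t\in E_t$; a value $d(v_t)\in\mathbb{R}$ for each $v_t\in V_t$ (positive: supply, negative: demand); a finite set $B$ of battery agents, each $b\in B$ having a location $v^b\in V$, battery nodes $b_1,\dots,b_T$, and battery edges $(b_t,b_{t+1})$, $t\in[T-1]$, with capacities $\kappa((b_t,b_{t+1}))\ge 0$. For each $b,t$ there are two transaction edges $(b_t,v^b_t)$ and $(v^b_t,b_t)$ (with infinite capacity under $\kappa$). The graph $G$ is the union of all $H_t$, all battery nodes, battery edges and transaction edges. In addition there is a source $x$ with edges $(x,v_t)$ of capacity $\max(0,d(v_t))$ and a target $y$ with edges $(v_t,y)$ of capacity $\max(0,-d(v_t))$, for all $v_t\in V_t$, $t\in[T]$. **Strategies.** A strategy of agent $b$ is a vector $s_b=(s_{b,t})_{t\in[T]}\in\mathbb{R}^{[T]}$ (positive entries: charging, negative: discharging) with $0\le\sum_{z=1}^t s_{b,z}\le\kappa((b_t,b_{t+1}))$ for each $t\in[T-1]$.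 A strategy profile $\mathbf{s}$ consists of one strategy per agent. **Flow.** Given $\mathbf{s}$, $\kappa_{\mathbf{s}}$ is defined by $\kappa_{\mathbf{s}}((v^b_t,b_t))=\max(0,s_{b,t})$, $\kappa_{\mathbf{s}}((b_t,v^b_t))=\max(0,-s_{b,t})$, and $\kappa_{\mathbf{s}}=\kappa$ on all other edges; $G_{\mathbf{s}}$ is the graph $G$ (with $x,y$) with capacities $\kappa_{\mathbf{s}}$. Flows are (real-valued) feasible $x$-$y$-flows, the value $|f|$ being the flow out of $x$; a maximum flow is one of maximum value. **Admissibility.** A transaction edge $e$ is admissible for $\mathbf{s}$ if every maximum flow $f$ in $G_{\mathbf{s}}$ saturates it, i.e. $f(e)=\kappa_{\mathbf{s}}(e)$. A strategy $s_b$ is admissible for $\mathbf{s}$ if all transaction edges of agent $b$ are admissible; $\mathbf{s}$ is admissible if all its strategies are. **Utilities.** For a price profile $\mathbf{p}=(p_t)_{t\in[T]}\in\mathbb{R}^{[T]}$, $u_b(\mathbf{s},\mathbf{p})=-\infty$ if $s_b$ is not admissible for $\mathbf{s}$, and $u_b(\mathbf{s},\mathbf{p})=-\sum_{t\in[T]}s_{b,t}p_t$ otherwise. **Nash equilibrium.** $\mathbf{s}$ is a (pure) Nash equilibrium for $\mathbf{p}$ if there is no agent $b$ with a strategy $s'_b$ such that $u_b((s'_b,\mathbf{s}_{-b}),\mathbf{p})>u_b(\mathbf{s},\mathbf{p})$. **Welfare and price of anarchy.** $W(\mathbf{s})$ is the value of a maximum flow in $G_{\mathbf{s}}$; $\mathrm{OPT}(G)$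 is a strategy profile of maximum welfare (over all strategy profiles); $\mathrm{worstNE}(G,\mathbf{p})$ is a Nash equilibrium for $\mathbf{p}$ of minimum welfare (the ratio below is read as the supremum of the ratios over all Nash equilibria). For a class $P$ of price profiles, $$\mathrm{PoA}_P=\sup_G\ \inf_{\mathbf{p}\in P}\frac{W(\mathrm{OPT}(G))}{W(\mathrm{worstNE}(G,\mathbf{p}))},$$ with $G$ ranging over all instances with the given number $T$ of time steps. Conventions: $0/0=1$, $a/0=\infty$ for $a>0$; the infimum is over those $\mathbf{p}\in P$ admitting a Nash equilibrium and the supremum over those $G$ for which such $\mathbf{p}$ exists. *)

theory Defs
  imports "HOL-Library.Extended_Real" "Graph_Theory.Pair_Digraph"
begin

record ('v, 'b) battery_game =
  horizon :: nat
  base :: "'v pair_pre_digraph"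
  grid_cap :: "nat \<Rightarrow> 'v \<times> 'v \<Rightarrow> real"
  net_supply :: "nat \<Rightarrow> 'v \<Rightarrow> real"
  agents :: "'b set"
  location :: "'b \<Rightarrow> 'v"
  store_cap :: "'b \<Rightarrow> nat \<Rightarrow> real"

text \<open>
  Here \<open>grid_cap G t e\<close> is the capacity of the copy of the base edge \<open>e\<close> at time \<open>t\<close>,
  \<open>net_supply G t v\<close> is \<open>d(v\<^sub>t)\<close> (negative values are demands), and \<open>store_cap G b t\<close> is the
  capacity of the battery edge from \<open>b\<^sub>t\<close> to \<open>b\<^sub>t\<^sub>+\<^sub>1\<close>.  Time steps are \<open>1, \<dots>, horizon G\<close>; all
  time-indexed functions are only ever inspected on the time steps that matter.
\<close>

definition battery_game :: "('v, 'b) battery_game \<Rightarrow> bool" where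
  "battery_game G \<longleftrightarrow>
     pair_fin_digraph (base G) \<and>
     (\<forall>t\<in>{1..horizon G}. \<forall>e\<in>parcs (base G). 0 \<le> grid_cap G t e) \<and>
     finite (agents G) \<and>
     (\<forall>b\<in>agents G. location G b \<in> pverts (base G)) \<and>
     (\<forall>b\<in>agents G. \<forall>t\<in>{1..<horizon G}. 0 \<le> store_cap G b t)"

datatype ('v, 'b) node = Source | Target | Grid 'v nat | Battery 'b nat

type_synonym ('v, 'b) edge = "('v, 'b) node \<times> ('v, 'b) node"

definition nodes :: "('v, 'b) battery_game \<Rightarrow> ('v, 'b) node set" where
  "nodes G = {Source, Target}
     \<union> {Grid v t | v t. v \<in> pverts (base G) \<and> t \<in> {1..horizon G}}
     \<union> {Battery b t | b t. b \<in> agents G \<and> t \<in> {1..horizon G}}"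

definition charge_edge :: "('v, 'b) battery_game \<Rightarrow> 'b \<Rightarrow> nat \<Rightarrow> ('v, 'b) edge" where
  "charge_edge G b t = (Grid (location G b) t, Battery b t)"

definition discharge_edge :: "('v, 'b) battery_game \<Rightarrow> 'b \<Rightarrow> nat \<Rightarrow> ('v, 'b) edge" where
  "discharge_edge G b t = (Battery b t, Grid (location G b) t)"

definition transaction_edges :: "('v, 'b) battery_game \<Rightarrow> 'b \<Rightarrow> ('v, 'b) edge set" where
  "transaction_edges G b =
     (\<Union>t\<in>{1..horizon G}. {charge_edge G b t, discharge_edge G b t})"

definition edges :: "('v, 'b) battery_game \<Rightarrow> ('v, 'b) edge set" where
  "edges G =
     {(Grid u t, Grid v t) | u v t. (u, v) \<in> parcs (base G) \<and> t \<in> {1..horizon G}}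
     \<union> {(Battery b t, Battery b (t + 1)) | b t. b \<in> agents G \<and> t \<in> {1..<horizon G}}
     \<union> (\<Union>b\<in>agents G. transaction_edges G b)
     \<union> {(Source, Grid v t) | v t. v \<in> pverts (base G) \<and> t \<in> {1..horizon G}}
     \<union> {(Grid v t, Target) | v t. v \<in> pverts (base G) \<and> t \<in> {1..horizon G}}"

type_synonym strategy = "nat \<Rightarrow> real"

type_synonym 'b profile = "'b \<Rightarrow> strategy"

text \<open>The prefix sums are constrained only before the last time step.\<close>

definition strategy :: "('v, 'b) battery_game \<Rightarrow> 'b \<Rightarrow> strategy \<Rightarrow> bool" where
  "strategy G b \<sigma> \<longleftrightarrow>
     (\<forall>t\<in>{1..<horizon G}. 0 \<le> (\<Sum>z=1..t. \<sigma> z) \<and> (\<Sum>z=1..t. \<sigma> z) \<le> store_cap G b t)"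

definition strategy_profile :: "('v, 'b) battery_game \<Rightarrow> 'b profile \<Rightarrow> bool" where
  "strategy_profile G s \<longleftrightarrow> (\<forall>b\<in>agents G. strategy G b (s b))"

text \<open>
  The capacities \<open>\<kappa>\<^sub>s\<close>.  They override the infinite capacity of all transaction edges, so real
  numbers suffice.  Pairs that are not of the shape of an edge get capacity 0, but only pairs in
  \<open>edges G\<close> are ever used.
\<close>

fun cap :: "('v, 'b) battery_game \<Rightarrow> 'b profile \<Rightarrow> ('v, 'b) edge \<Rightarrow> real" where
  "cap G s (Grid u t, Grid v t') = grid_cap G t (u, v)"
| "cap G s (Battery b t, Battery b' t') = store_cap G b t"
| "cap G s (Grid v t, Battery b t') = max 0 (s b t)"
| "cap G s (Battery b t, Grid v t') = max 0 (- s b t)"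
| "cap G s (Source, Grid v t) = max 0 (net_supply G t v)"
| "cap G s (Grid v t, Target) = max 0 (- net_supply G t v)"
| "cap G s _ = 0"

definition flow ::
  "('v, 'b) battery_game \<Rightarrow> 'b profile \<Rightarrow> (('v, 'b) edge \<Rightarrow> real) \<Rightarrow> bool" where
  "flow G s f \<longleftrightarrow>
     (\<forall>e\<in>edges G. 0 \<le> f e \<and> f e \<le> cap G s e) \<and>
     (\<forall>w\<in>nodes G - {Source, Target}.
        (\<Sum>e | e \<in> edges G \<and> snd e = w. f e) = (\<Sum>e | e \<in> edges G \<and> fst e = w. f e))"

definition flow_value :: "('v, 'b) battery_game \<Rightarrow> (('v, 'b) edge \<Rightarrow> real) \<Rightarrow> real" where
  "flow_value G f = (\<Sum>e | e \<in> edges G \<and> fst e = Source. f e)"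

definition max_flow ::
  "('v, 'b) battery_game \<Rightarrow> 'b profile \<Rightarrow> (('v, 'b) edge \<Rightarrow> real) \<Rightarrow> bool" where
  "max_flow G s f \<longleftrightarrow> flow G s f \<and> (\<forall>g. flow G s g \<longrightarrow> flow_value G g \<le> flow_value G f)"

definition admissible_edge ::
  "('v, 'b) battery_game \<Rightarrow> 'b profile \<Rightarrow> ('v, 'b) edge \<Rightarrow> bool" where
  "admissible_edge G s e \<longleftrightarrow> (\<forall>f. max_flow G s f \<longrightarrow> f e = cap G s e)"

definition admissible :: "('v, 'b) battery_game \<Rightarrow> 'b profile \<Rightarrow> 'b \<Rightarrow> bool" where
  "admissible G s b \<longleftrightarrow> (\<forall>e\<in>transaction_edges G b. admissible_edge G s e)"

type_synonym prices = "nat \<Rightarrow> real"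

definition utility :: "('v, 'b) battery_game \<Rightarrow> 'b \<Rightarrow> 'b profile \<Rightarrow> prices \<Rightarrow> ereal" where
  "utility G b s p =
     (if admissible G s b then ereal (- (\<Sum>t=1..horizon G. s b t * p t)) else - \<infinity>)"

definition nash_equilibrium :: "('v, 'b) battery_game \<Rightarrow> prices \<Rightarrow> 'b profile \<Rightarrow> bool" where
  "nash_equilibrium G p s \<longleftrightarrow>
     strategy_profile G s \<and>
     \<not> (\<exists>b\<in>agents G. \<exists>\<sigma>. strategy G b \<sigma> \<and> utility G b (s(b := \<sigma>)) p > utility G b s p)"

text \<open>
  Maximum flows exist by compactness, and all of them have the same value.  A welfare-optimal
  profile exists as well: it is obtained by netting the transactions of a maximum flow for
  unbounded transaction capacities.  Hence both choice operators below are well-defined.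
\<close>

definition welfare :: "('v, 'b) battery_game \<Rightarrow> 'b profile \<Rightarrow> real" where
  "welfare G s = (THE w. \<exists>f. max_flow G s f \<and> w = flow_value G f)"

definition optimal_profile :: "('v, 'b) battery_game \<Rightarrow> 'b profile \<Rightarrow> bool" where
  "optimal_profile G s \<longleftrightarrow>
     strategy_profile G s \<and> (\<forall>s'. strategy_profile G s' \<longrightarrow> welfare G s' \<le> welfare G s)"

definition OPT :: "('v, 'b) battery_game \<Rightarrow> 'b profile" where
  "OPT G = (SOME s. optimal_profile G s)"

text \<open>Division with \<open>0/0 = 1\<close> and \<open>a/0 = \<infinity>\<close> for positive \<open>a\<close>; welfare is never negative.\<close>

definition welfare_ratio :: "real \<Rightarrow> real \<Rightarrow> ereal" where
  "welfare_ratio a c = (if c = 0 then (if a = 0 then 1 else \<infinity>) else ereal (a / c))"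

definition anarchy_ratio :: "('v, 'b) battery_game \<Rightarrow> prices \<Rightarrow> ereal" where
  "anarchy_ratio G p =
     (SUP s\<in>{s. nash_equilibrium G p s}. welfare_ratio (welfare G (OPT G)) (welfare G s))"

text \<open>
  Up to isomorphism, every finite instance has natural numbers as vertices and agents, so the
  supremum over all instances can be taken over this type.  Parallel edges in the base graph are
  not needed, because they can be merged by adding up their capacities.
\<close>

definition PoA :: "nat \<Rightarrow> prices set \<Rightarrow> ereal" where
  "PoA T P =
     (SUP G\<in>{G :: (nat, nat) battery_game. battery_game G \<and> horizon G = T \<and>
               (\<exists>p\<in>P. \<exists>s. nash_equilibrium G p s)}.
        INF p\<in>{p\<in>P. \<exists>s. nash_equilibrium G p s}. anarchy_ratio G p)"

end

theory Submission
  imports Defs "HOL-Analysis.Function_Topology"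
begin

text \<open>
  With two time steps an admissible agent sells exactly what it bought, so its utility is its
  first transaction times \<open>p 2 - p 1\<close>.  One instance serves all prices.  Two units of
  supply at time 1 have to be carried to two units of demand at time 2, and the agents, seen as
  edges between supplies and demands, form a path with three edges.  The two outer agents together
  carry both units.  If prices do not decrease, it is an equilibrium that only the middle agent
  trades: any other agent would compete with it for its supply or its demand, so some maximum flow
  would bypass the newcomer, whose trade is thus not admissible.  If prices decrease, not trading
  at all is an equilibrium.
\<close>

section \<open>Maximum flows and welfare in arbitrary instances\<close>

text \<open>Unions of images can be evaluated by simp once the index sets are explicit; the
  comprehensions of the definition hide existential quantifiers.\<close>

lemma edges_eq:
  "edges G =
     (\<Union>t\<in>{1..horizon G}. (\<lambda>(u, v). (Grid u t, Grid v t)) ` parcs (base G))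
     \<union> (\<Union>b\<in>agents G. (\<lambda>t. (Battery b t, Battery b (t + 1))) ` {1..<horizon G})
     \<union> (\<Union>b\<in>agents G. transaction_edges G b)
     \<union> (\<Union>t\<in>{1..horizon G}. (\<lambda>v. (Source, Grid v t)) ` pverts (base G))
     \<union> (\<Union>t\<in>{1..horizon G}. (\<lambda>v. (Grid v t, Target)) ` pverts (base G))"
  unfolding edges_def by force

lemma cap_nonneg:
  assumes G: "battery_game G" and e: "e \<in> edges G"
  shows "0 \<le> cap G s e"
proof -
  from e consider
      (grid) u v t where "e = (Grid u t, Grid v t)" "(u, v) \<in> parcs (base G)" "t \<in> {1..horizon G}"
    | (store) b t where "e = (Battery b t, Battery b (t + 1))" "b \<in> agents G" "t \<in> {1..<horizon G}"
    | (trans) b t where "e = charge_edge G b t \<or> e = discharge_edge G b t"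
    | (ends) v t where "e = (Source, Grid v t) \<or> e = (Grid v t, Target)"
    unfolding edges_def transaction_edges_def by blast
  then show ?thesis
  proof cases
    case grid
    with G show ?thesis
      unfolding battery_game_def by (metis cap.simps(1))
  next
    case store
    with G show ?thesis
      unfolding battery_game_def by (metis cap.simps(2))
  qed (auto simp: charge_edge_def discharge_edge_def)
qed

text \<open>Flows that vanish off the edges form a compact set in the product topology, and a
  continuous function attains its supremum there.\<close>

lemma max_flow_exists:
  fixes G :: "('a, 'b) battery_game"
  assumes "battery_game G"
  obtains f where "max_flow G s f"
proof -
  \<comment> \<open>Every factor is a compact interval or \<open>{0}\<close>, so the whole product
    is compact by Tychonoff.\<close>
  let ?K = "PiE UNIV (\<lambda>e. if e \<in> edges G then {0..cap G s e} else {0})"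
  let ?C = "\<lambda>w. {f :: _ \<Rightarrow> real.
    (\<Sum>e | e \<in> edges G \<and> snd e = w. f e) = (\<Sum>e | e \<in> edges G \<and> fst e = w. f e)}"
  let ?F = "?K \<inter> (\<Inter>w\<in>nodes G - {Source, Target}. ?C w)"
  have coord: "continuous_on A (\<lambda>f :: _ \<Rightarrow> real. f e)" for A and e :: "('a, 'b) edge"
    by (rule continuous_on_product_then_coordinatewise[OF continuous_on_id])
  have "compactin (product_topology (\<lambda>_. euclidean) UNIV) ?K"
    by (subst compactin_PiE) (auto simp: compactin_euclidean_iff)
  then have "compact ?K"
    by (simp add: euclidean_product_topology flip: compactin_euclidean_iff)
  moreover have "closed (?C w)" for w
    by (intro closed_Collect_eq continuous_on_sum coord)
  ultimately have "compact ?F"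
    by (intro compact_Int_closed closed_INT) auto
  moreover have "(\<lambda>_. 0) \<in> ?F"
    using cap_nonneg[OF assms] by auto
  moreover have "continuous_on ?F (flow_value G)"
    unfolding flow_value_def by (intro continuous_on_sum coord)
  ultimately obtain f where f: "f \<in> ?F" "\<forall>g\<in>?F. flow_value G g \<le> flow_value G f"
    using continuous_attains_sup[of ?F "flow_value G"] by blast
  have "flow G s f"
    using f(1) unfolding flow_def PiE_UNIV_domain Pi_def by (auto split: if_splits)
  moreover have "flow_value G g \<le> flow_value G f" if g: "flow G s g" for g
  proof -
    \<comment> \<open>A flow is unconstrained off the edges; cutting it off there puts it into the
      compact set without changing its value.\<close>
    let ?g = "\<lambda>e. if e \<in> edges G then g e else 0"
    have "?g \<in> ?F"
      using g by (auto simp: flow_def intro!: sum.cong)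
    moreover have "flow_value G ?g = flow_value G g"
      unfolding flow_value_def by (rule sum.cong) auto
    ultimately show ?thesis
      using bspec[OF f(2), of ?g] by simp
  qed
  ultimately show ?thesis
    using that by (auto simp: max_flow_def)
qed

lemma welfare_eq:
  assumes "max_flow G s f"
  shows "welfare G s = flow_value G f"
  unfolding welfare_def
  using assms by (intro the_equality) (auto simp: max_flow_def intro: order.antisym)

lemma welfare_le:
  assumes "battery_game G" "\<And>f. flow G s f \<Longrightarrow> flow_value G f \<le> c"
  shows "welfare G s \<le> c"
  using max_flow_exists[OF assms(1), of s] assms(2) welfare_eq max_flow_def by metis

text \<open>The choice operator picks an unknown optimum, but all optima have the same welfare, so
  exhibiting one of them determines the welfare of \<open>OPT G\<close>.\<close>

lemma welfare_OPT:
  assumes "optimal_profile G s"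
  shows "welfare G (OPT G) = welfare G s"
proof -
  have "optimal_profile G (OPT G)"
    unfolding OPT_def using assms by (metis someI)
  with assms show ?thesis
    by (auto simp: optimal_profile_def intro: order.antisym)
qed

lemma transaction_edges_subset: "b \<in> agents G \<Longrightarrow> transaction_edges G b \<subseteq> edges G"
  by (auto simp: edges_def)

text \<open>The transaction edges of an idle agent have capacity 0, so every flow saturates
  them.\<close>

lemma admissible_zero:
  assumes "b \<in> agents G" "\<And>t. s b t = 0"
  shows "admissible G s b"
proof -
  have "f e = cap G s e" if "max_flow G s f" "e \<in> transaction_edges G b" for f e
  proof -
    have "cap G s e = 0"
      using that(2) assms(2)
      by (auto simp: transaction_edges_def charge_edge_def discharge_edge_def)
    moreover have "0 \<le> f e \<and> f e \<le> cap G s e"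
      using that transaction_edges_subset[OF assms(1)] by (auto simp: max_flow_def flow_def)
    ultimately show ?thesis
      by simp
  qed
  then show ?thesis
    by (simp add: admissible_def admissible_edge_def)
qed

section \<open>Utilities and equilibria for two time steps\<close>

text \<open>Only the prefix sum at time 1 is constrained. The second entry is free as far as
  strategies go; admissibility is what ties it to the first.\<close>

lemma strategy_two_periods:
  assumes "horizon G = 2"
  shows "strategy G b \<sigma> \<longleftrightarrow> 0 \<le> \<sigma> 1 \<and> \<sigma> 1 \<le> store_cap G b 1"
proof -
  have "{1..<2::nat} = {1}"
    by auto
  with assms show ?thesis
    by (simp add: strategy_def)
qed

text \<open>Saturation fixes the flow on all four transaction edges of the agent; conservation at
  its two battery nodes then equates what is stored at time 1 with what is released at time
  2.\<close>

lemma admissible_two_periods: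
  assumes G: "battery_game G" "horizon G = 2" and b: "b \<in> agents G"
    and "strategy G b (s b)" "admissible G s b"
  shows "s b 2 = - s b 1"
proof -
  obtain f where f: "max_flow G s f"
    using max_flow_exists[OF G(1)] .
  have sat: "f e = cap G s e" if "e \<in> transaction_edges G b" for e
    using assms f that by (auto simp: admissible_def admissible_edge_def)
  have nonneg: "0 \<le> s b 1"
    using assms by (simp add: strategy_two_periods)
  have bal: "(\<Sum>e | e \<in> edges G \<and> snd e = w. f e) = (\<Sum>e | e \<in> edges G \<and> fst e = w. f e)"
    if "w \<in> {Battery b 1, Battery b 2}" for w
    using f that b G(2) by (auto simp: max_flow_def flow_def nodes_def)
  let ?store = "(Battery b 1, Battery b 2)"
  have "{e. e \<in> edges G \<and> snd e = Battery b 1} = {charge_edge G b 1}"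
    "{e. e \<in> edges G \<and> fst e = Battery b 1} = {discharge_edge G b 1, ?store}"
    "{e. e \<in> edges G \<and> snd e = Battery b 2} = {charge_edge G b 2, ?store}"
    "{e. e \<in> edges G \<and> fst e = Battery b 2} = {discharge_edge G b 2}"
    using b G(2)
    by (auto simp: edges_def transaction_edges_def charge_edge_def discharge_edge_def)
  with bal[of "Battery b 1"] bal[of "Battery b 2"]
  have "f (charge_edge G b 1) = f (discharge_edge G b 1) + f ?store"
    "f (charge_edge G b 2) + f ?store = f (discharge_edge G b 2)"
    by (simp_all add: charge_edge_def discharge_edge_def)
  moreover have "f (charge_edge G b t) = max 0 (s b t)" "f (discharge_edge G b t) = max 0 (- s b t)"
    if "t \<in> {1, 2}" for t
    using that G(2) sat[of "charge_edge G b t"] sat[of "discharge_edge G b t"]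
    by (auto simp: transaction_edges_def charge_edge_def discharge_edge_def)
  ultimately show ?thesis
    using nonneg by (auto simp: max_def split: if_splits)
qed

lemma utility_two_periods:
  assumes "battery_game G" "horizon G = 2" "b \<in> agents G"
    and "strategy G b (s b)" "admissible G s b"
  shows "utility G b s p = ereal (s b 1 * (p 2 - p 1))"
  using assms admissible_two_periods[OF assms]
  by (simp add: utility_def numeral_2_eq_2 algebra_simps)

text \<open>A deviation that is not admissible has utility -\<infinity>, so only admissible ones
  have to be compared, through their first transactions.\<close>

lemma nash_equilibrium_two_periods:
  assumes G: "battery_game G" "horizon G = 2" and s: "strategy_profile G s"
    and adm: "\<And>b. b \<in> agents G \<Longrightarrow> admissible G s b"
    and dev: "\<And>b \<sigma>. \<lbrakk>b \<in> agents G; strategy G b \<sigma>; admissible G (s(b := \<sigma>)) b\<rbrakk>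
      \<Longrightarrow> \<sigma> 1 * (p 2 - p 1) \<le> s b 1 * (p 2 - p 1)"
  shows "nash_equilibrium G p s"
proof -
  have "utility G b (s(b := \<sigma>)) p \<le> utility G b s p" if "b \<in> agents G" "strategy G b \<sigma>" for b \<sigma>
  proof (cases "admissible G (s(b := \<sigma>)) b")
    case True
    with that s dev[OF that True] adm show ?thesis
      by (simp add: utility_two_periods G strategy_profile_def)
  qed (simp add: utility_def)
  with s show ?thesis
    by (auto simp: nash_equilibrium_def not_less)
qed

section \<open>Lower bounds on the price of anarchy\<close>

text \<open>For a single price profile the infimum collapses to \<open>anarchy_ratio G p\<close>, so
  one equilibrium of one instance bounds both suprema from below.\<close>

lemma PoA_singleton_ge:
  fixes G :: "(nat, nat) battery_game"
  assumes "battery_game G" "horizon G = T" "nash_equilibrium G p s"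
    and "c \<le> welfare_ratio (welfare G (OPT G)) (welfare G s)"
  shows "c \<le> PoA T {p}"
proof -
  have "c \<le> anarchy_ratio G p"
    unfolding anarchy_ratio_def using assms by (intro SUP_upper2) auto
  moreover have "{q \<in> {p}. \<exists>s. nash_equilibrium G q s} = {p}"
    using assms by auto
  ultimately show ?thesis
    unfolding PoA_def using assms by (intro SUP_upper2[of G]) auto
qed

section \<open>A concrete instance and its network\<close>

text \<open>
  The supplies at time 1 are at 0 and 2, the demands at time 2 at 0 and 1.  Agent 0 joins supply 0
  to demand 0.  The edge \<open>(0, 1)\<close>, open only at time 1, lets agent 1 join supply 0 to
  demand 1; the edge \<open>(2, 0)\<close>, open only at time 2, lets agent 2 join supply 2 to demand 0.
\<close>

definition path_game :: "(nat, nat) battery_game" where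
  "path_game = \<lparr>
     horizon = 2,
     base = \<lparr>pverts = {0, 1, 2}, parcs = {(0, 1), (2, 0)}\<rparr>,
     grid_cap = (\<lambda>t e. if (t, e) \<in> {(1, (0, 1)), (2, (2, 0))} then 1 else 0),
     net_supply = (\<lambda>t v. if (t, v) \<in> {(1, 0), (1, 2)} then 1
       else if (t, v) \<in> {(2, 0), (2, 1)} then -1 else 0),
     agents = {0, 1, 2},
     location = id,
     store_cap = (\<lambda>_ _. 1)\<rparr>"

lemma path_game_simps [simp]:
  "horizon path_game = 2"
  "base path_game = \<lparr>pverts = {0, 1, 2}, parcs = {(0, 1), (2, 0)}\<rparr>"
  "grid_cap path_game t e = (if (t, e) \<in> {(1, (0, 1)), (2, (2, 0))} then 1 else 0)"
  "net_supply path_game t v = (if (t, v) \<in> {(1, 0), (1, 2)} then 1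
     else if (t, v) \<in> {(2, 0), (2, 1)} then -1 else 0)"
  "agents path_game = {0, 1, 2}"
  "location path_game = id"
  "store_cap path_game = (\<lambda>_ _. 1)"
  by (simp_all add: path_game_def)

lemma battery_game_path_game: "battery_game path_game"
proof -
  have "pair_fin_digraph (base path_game)"
    by unfold_locales auto
  then show ?thesis
    by (auto simp: battery_game_def path_game_def)
qed

text \<open>A distinct list lets simp expand sums over edges term by term.\<close>

definition path_game_edges :: "(nat, nat) edge list" where
  "path_game_edges = concat (map (\<lambda>t.
     [(Grid 0 t, Grid 1 t), (Grid 2 t, Grid 0 t)] @
     concat (map (\<lambda>v. [(Source, Grid v t), (Grid v t, Target),
       (Grid v t, Battery v t), (Battery v t, Grid v t)]) [0, 1, 2])) [1, 2]) @
     map (\<lambda>b. (Battery b 1, Battery b 2)) [0, 1, 2]"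

lemma edges_path_game: "edges path_game = set path_game_edges" (is "?L = ?R")
proof
  have Icc: "{1..2::nat} = {1, 2}" and Ico: "{1..<2::nat} = {1}"
    by auto
  show "?L \<subseteq> ?R"
    \<comment> \<open>\<open>One_nat_def\<close> would turn \<open>1\<close> into
      \<open>Suc 0\<close>, and \<open>Icc\<close> and \<open>Ico\<close> would no longer
      match.\<close>
    by (simp add: edges_eq path_game_edges_def transaction_edges_def charge_edge_def
        discharge_edge_def Icc Ico del: One_nat_def)
  show "?R \<subseteq> ?L"
    by (simp add: edges_eq path_game_edges_def transaction_edges_def charge_edge_def
        discharge_edge_def Icc Ico del: One_nat_def)
qed

lemma sum_edges_path_game:
  "(\<Sum>e | e \<in> edges path_game \<and> P e. f e) =
   (\<Sum>e\<leftarrow>path_game_edges. if P e then f e else (0 :: real))"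
proof -
  have "distinct path_game_edges"
    by (simp add: path_game_edges_def)
  then have "(\<Sum>e\<leftarrow>path_game_edges. if P e then f e else 0) =
      (\<Sum>e\<in>set path_game_edges. if P e then f e else 0)"
    by (rule sum.distinct_set_conv_list[symmetric])
  then show ?thesis
    by (simp add: edges_path_game sum.inter_filter)
qed

lemma flow_value_path_game:
  "flow_value path_game f =
     f (Source, Grid 0 1) + f (Source, Grid 1 1) + f (Source, Grid 2 1) +
     f (Source, Grid 0 2) + f (Source, Grid 1 2) + f (Source, Grid 2 2)"
  by (simp add: flow_value_def sum_edges_path_game path_game_edges_def del: One_nat_def)

lemma nodes_path_game:
  "nodes path_game - {Source, Target} =
     {Grid 0 1, Grid 1 1, Grid 2 1, Grid 0 2, Grid 1 2, Grid 2 2,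
      Battery 0 1, Battery 1 1, Battery 2 1, Battery 0 2, Battery 1 2, Battery 2 2}"
proof -
  have Icc: "{1..2::nat} = {1, 2}"
    by auto
  show ?thesis
    unfolding nodes_def path_game_simps Icc by auto
qed

text \<open>Serves in both directions: to extract equations from a given flow and to verify explicit
  flows.\<close>

lemma conservation_path_game:
  fixes f :: "(nat, nat) edge \<Rightarrow> real"
  shows "(\<forall>w\<in>nodes path_game - {Source, Target}.
      (\<Sum>e | e \<in> edges path_game \<and> snd e = w. f e) =
      (\<Sum>e | e \<in> edges path_game \<and> fst e = w. f e)) \<longleftrightarrow>
    f (Grid 2 1, Grid 0 1) + (f (Source, Grid 0 1) + f (Battery 0 1, Grid 0 1)) =
      f (Grid 0 1, Grid 1 1) + (f (Grid 0 1, Target) + f (Grid 0 1, Battery 0 1)) \<and>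
    f (Grid 0 1, Grid 1 1) + (f (Source, Grid 1 1) + f (Battery 1 1, Grid 1 1)) =
      f (Grid 1 1, Target) + f (Grid 1 1, Battery 1 1) \<and>
    f (Source, Grid 2 1) + f (Battery 2 1, Grid 2 1) =
      f (Grid 2 1, Grid 0 1) + (f (Grid 2 1, Target) + f (Grid 2 1, Battery 2 1)) \<and>
    f (Grid 2 2, Grid 0 2) + (f (Source, Grid 0 2) + f (Battery 0 2, Grid 0 2)) =
      f (Grid 0 2, Grid 1 2) + (f (Grid 0 2, Target) + f (Grid 0 2, Battery 0 2)) \<and>
    f (Grid 0 2, Grid 1 2) + (f (Source, Grid 1 2) + f (Battery 1 2, Grid 1 2)) =
      f (Grid 1 2, Target) + f (Grid 1 2, Battery 1 2) \<and>
    f (Source, Grid 2 2) + f (Battery 2 2, Grid 2 2) =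
      f (Grid 2 2, Grid 0 2) + (f (Grid 2 2, Target) + f (Grid 2 2, Battery 2 2)) \<and>
    f (Grid 0 1, Battery 0 1) = f (Battery 0 1, Grid 0 1) + f (Battery 0 1, Battery 0 2) \<and>
    f (Grid 1 1, Battery 1 1) = f (Battery 1 1, Grid 1 1) + f (Battery 1 1, Battery 1 2) \<and>
    f (Grid 2 1, Battery 2 1) = f (Battery 2 1, Grid 2 1) + f (Battery 2 1, Battery 2 2) \<and>
    f (Grid 0 2, Battery 0 2) + f (Battery 0 1, Battery 0 2) = f (Battery 0 2, Grid 0 2) \<and>
    f (Grid 1 2, Battery 1 2) + f (Battery 1 1, Battery 1 2) = f (Battery 1 2, Grid 1 2) \<and>
    f (Grid 2 2, Battery 2 2) + f (Battery 2 1, Battery 2 2) = f (Battery 2 2, Grid 2 2)"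
  unfolding nodes_path_game sum_edges_path_game path_game_edges_def ball_simps
  by (simp del: One_nat_def)

section \<open>Upper bounds for flows in the instance\<close>

text \<open>These are the conservation equations after removing the ten grid, source and target
  edges that have capacity 0 in every profile.\<close>

lemma flow_path_gameD:
  assumes "flow path_game s f"
  shows "flow_value path_game f = f (Source, Grid 0 1) + f (Source, Grid 2 1)"
    and "f (Source, Grid 0 1) + f (Battery 0 1, Grid 0 1) =
      f (Grid 0 1, Grid 1 1) + f (Grid 0 1, Battery 0 1)"
    and "f (Grid 0 1, Grid 1 1) + f (Battery 1 1, Grid 1 1) = f (Grid 1 1, Battery 1 1)"
    and "f (Source, Grid 2 1) + f (Battery 2 1, Grid 2 1) = f (Grid 2 1, Battery 2 1)"
    and "f (Grid 2 2, Grid 0 2) + f (Battery 0 2, Grid 0 2) =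
      f (Grid 0 2, Target) + f (Grid 0 2, Battery 0 2)"
    and "f (Battery 1 2, Grid 1 2) = f (Grid 1 2, Target) + f (Grid 1 2, Battery 1 2)"
    and "f (Battery 2 2, Grid 2 2) = f (Grid 2 2, Grid 0 2) + f (Grid 2 2, Battery 2 2)"
    and "f (Grid 0 1, Battery 0 1) = f (Battery 0 1, Grid 0 1) + f (Battery 0 1, Battery 0 2)"
    and "f (Grid 1 1, Battery 1 1) = f (Battery 1 1, Grid 1 1) + f (Battery 1 1, Battery 1 2)"
    and "f (Grid 2 1, Battery 2 1) = f (Battery 2 1, Grid 2 1) + f (Battery 2 1, Battery 2 2)"
    and "f (Grid 0 2, Battery 0 2) + f (Battery 0 1, Battery 0 2) = f (Battery 0 2, Grid 0 2)"
    and "f (Grid 1 2, Battery 1 2) + f (Battery 1 1, Battery 1 2) = f (Battery 1 2, Grid 1 2)"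
    and "f (Grid 2 2, Battery 2 2) + f (Battery 2 1, Battery 2 2) = f (Battery 2 2, Grid 2 2)"
proof -
  have bounds: "0 \<le> f e \<and> f e \<le> cap path_game s e" if "e \<in> set path_game_edges" for e
    using assms that by (simp add: flow_def edges_path_game)
  have zero_cap: "f e = 0" if "e \<in> set path_game_edges" "cap path_game s e = 0" for e
    using bounds[OF that(1)] that(2) by simp
  have "f (Grid 2 1, Grid 0 1) = 0" "f (Grid 0 2, Grid 1 2) = 0"
    "f (Source, Grid 1 1) = 0" "f (Source, Grid 0 2) = 0" "f (Source, Grid 1 2) = 0"
    "f (Source, Grid 2 2) = 0" "f (Grid 0 1, Target) = 0" "f (Grid 1 1, Target) = 0"
    "f (Grid 2 1, Target) = 0" "f (Grid 2 2, Target) = 0"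
    by (rule zero_cap; simp add: path_game_edges_def)+
  note zeros = this
  have "\<forall>w\<in>nodes path_game - {Source, Target}.
      (\<Sum>e | e \<in> edges path_game \<and> snd e = w. f e) =
      (\<Sum>e | e \<in> edges path_game \<and> fst e = w. f e)"
    using assms unfolding flow_def by (rule conjunct2)
  note cons = this[unfolded conservation_path_game zeros add_0_left add_0_right]
  show "flow_value path_game f = f (Source, Grid 0 1) + f (Source, Grid 2 1)"
    unfolding flow_value_path_game zeros by simp
  from cons show
    "f (Source, Grid 0 1) + f (Battery 0 1, Grid 0 1) =
      f (Grid 0 1, Grid 1 1) + f (Grid 0 1, Battery 0 1)"
    "f (Grid 0 1, Grid 1 1) + f (Battery 1 1, Grid 1 1) = f (Grid 1 1, Battery 1 1)"
    "f (Source, Grid 2 1) + f (Battery 2 1, Grid 2 1) = f (Grid 2 1, Battery 2 1)"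
    "f (Grid 2 2, Grid 0 2) + f (Battery 0 2, Grid 0 2) =
      f (Grid 0 2, Target) + f (Grid 0 2, Battery 0 2)"
    "f (Battery 1 2, Grid 1 2) = f (Grid 1 2, Target) + f (Grid 1 2, Battery 1 2)"
    "f (Battery 2 2, Grid 2 2) = f (Grid 2 2, Grid 0 2) + f (Grid 2 2, Battery 2 2)"
    "f (Grid 0 1, Battery 0 1) = f (Battery 0 1, Grid 0 1) + f (Battery 0 1, Battery 0 2)"
    "f (Grid 1 1, Battery 1 1) = f (Battery 1 1, Grid 1 1) + f (Battery 1 1, Battery 1 2)"
    "f (Grid 2 1, Battery 2 1) = f (Battery 2 1, Grid 2 1) + f (Battery 2 1, Battery 2 2)"
    "f (Grid 0 2, Battery 0 2) + f (Battery 0 1, Battery 0 2) = f (Battery 0 2, Grid 0 2)"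
    "f (Grid 1 2, Battery 1 2) + f (Battery 1 1, Battery 1 2) = f (Battery 1 2, Grid 1 2)"
    "f (Grid 2 2, Battery 2 2) + f (Battery 2 1, Battery 2 2) = f (Battery 2 2, Grid 2 2)"
    by - (elim conjE, assumption)+
qed

lemma flow_path_game_cap:
  assumes "flow path_game s f"
  shows "v \<in> {0, 2} \<Longrightarrow> f (Source, Grid v 1) \<le> 1"
    and "v \<in> {0, 1} \<Longrightarrow> f (Grid v 2, Target) \<le> 1"
    and "\<lbrakk>b \<in> {0, 1, 2}; t \<in> {1, 2}\<rbrakk> \<Longrightarrow>
      f (Grid b t, Battery b t) \<in> {0..max 0 (s b t)} \<and> f (Battery b t, Grid b t) \<in> {0..max 0 (- s b t)}"
proof -
  have bounds: "0 \<le> f e" "f e \<le> cap path_game s e" if "e \<in> set path_game_edges" for e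
    using assms that by (simp_all add: flow_def edges_path_game)
  show "f (Source, Grid v 1) \<le> 1" if "v \<in> {0, 2}"
    using bounds(2)[of "(Source, Grid v 1)"] that by (auto simp: path_game_edges_def)
  show "f (Grid v 2, Target) \<le> 1" if "v \<in> {0, 1}"
    using bounds(2)[of "(Grid v 2, Target)"] that by (auto simp: path_game_edges_def)
  show "f (Grid b t, Battery b t) \<in> {0..max 0 (s b t)} \<and>
      f (Battery b t, Grid b t) \<in> {0..max 0 (- s b t)}" if "b \<in> {0, 1, 2}" "t \<in> {1, 2}"
    using bounds[of "(Grid b t, Battery b t)"] bounds[of "(Battery b t, Grid b t)"] that
    by (auto simp: path_game_edges_def)
qed

lemma flow_path_game_le_2:
  assumes "flow path_game s f"
  shows "flow_value path_game f \<le> 2"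
  using flow_path_gameD(1)[OF assms] flow_path_game_cap(1)[OF assms, of 0]
    flow_path_game_cap(1)[OF assms, of 2] by simp

text \<open>Supply 2 can leave only through agent 2, and demand 1 can be reached only through agent
  1. Either of them being idle cuts off one unit. The disjunction covers deviations of agent 1 and
  of agent 2 from a profile in which both are idle.\<close>

lemma flow_path_game_le_1:
  assumes f: "flow path_game s f" and "s 1 2 = 0 \<or> s 2 1 = 0"
  shows "flow_value path_game f \<le> 1"
  using assms(2)
proof
  assume "s 2 1 = 0"
  then have "f (Grid 2 1, Battery 2 1) = 0" "0 \<le> f (Battery 2 1, Grid 2 1)"
    using flow_path_game_cap(3)[OF f, of 2 1] by auto
  then show ?thesis
    using flow_path_gameD(1,4)[OF f] flow_path_game_cap(1)[OF f, of 0] by simp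
next
  assume "s 1 2 = 0"
  then have "f (Battery 1 2, Grid 1 2) = 0" "0 \<le> f (Grid 1 2, Battery 1 2)"
    using flow_path_game_cap(3)[OF f, of 1 2] by auto
  moreover have "f (Grid 0 2, Target) \<le> 1"
    using flow_path_game_cap(2)[OF f] by auto
  \<comment> \<open>Added up, the conservation equations equate the flow value with the flow into
    \<open>Target\<close>, here only through \<open>Grid 0 2\<close>.\<close>
  ultimately show ?thesis
    using flow_path_gameD[OF f] by linarith
qed

lemma flow_path_game_le_0:
  assumes f: "flow path_game (\<lambda>_ _. 0) f"
  shows "flow_value path_game f \<le> 0"
proof -
  have "f (Grid b t, Battery b t) = 0" "f (Battery b t, Grid b t) = 0"
    if "b \<in> {0, 1, 2}" "t \<in> {1, 2}" for b t
    using flow_path_game_cap(3)[OF f that] by auto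
  from this[of _ 1] show ?thesis
    using flow_path_gameD(1-4)[OF f] by simp
qed

text \<open>With agents 1 and 2 idle, supply 2 is cut off and the grid edge \<open>(0, 1)\<close> is
  a dead end, so the whole unit has to pass through agent 0.\<close>

lemma flow_path_game_saturated:
  assumes f: "flow path_game s f" and one: "1 \<le> flow_value path_game f"
    and s: "s 0 1 = 1" "s 0 2 = -1" "s 1 1 = 0" "s 2 1 = 0"
  shows "f (Grid 0 1, Battery 0 1) = 1" "f (Battery 0 1, Grid 0 1) = 0"
    "f (Grid 0 2, Battery 0 2) = 0" "f (Battery 0 2, Grid 0 2) = 1"
proof -
  have idle: "f (Grid b 1, Battery b 1) = 0" "f (Battery b 1, Grid b 1) = 0" if "b \<in> {1, 2}" for b
    using flow_path_game_cap(3)[OF f, of b 1] that s by auto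
  show z: "f (Battery 0 1, Grid 0 1) = 0" "f (Grid 0 2, Battery 0 2) = 0"
    using flow_path_game_cap(3)[OF f, of 0 1] flow_path_game_cap(3)[OF f, of 0 2] s by auto
  have "f (Grid 0 1, Battery 0 1) \<le> 1"
    using flow_path_game_cap(3)[OF f, of 0 1] s by auto
  with one idle z show full: "f (Grid 0 1, Battery 0 1) = 1"
    using flow_path_gameD(1-4)[OF f] by simp
  from full z show "f (Battery 0 2, Grid 0 2) = 1"
    using flow_path_gameD(8,11)[OF f] by simp
qed

section \<open>Explicit flows and the optimal welfare\<close>

text \<open>The witness flows are unions of edge-disjoint unit paths, so each is the indicator of
  its edge set.\<close>

lemma flow_of_bool:
  assumes "battery_game G" "\<And>e. e \<in> P \<Longrightarrow> 1 \<le> cap G s e"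
    and "\<forall>w\<in>nodes G - {Source, Target}.
      (\<Sum>e | e \<in> edges G \<and> snd e = w. of_bool (e \<in> P)) =
      (\<Sum>e | e \<in> edges G \<and> fst e = w. of_bool (e \<in> P) :: real)"
  shows "flow G s (\<lambda>e. of_bool (e \<in> P))"
  using assms(2,3) cap_nonneg[OF assms(1)] by (auto simp: flow_def)

text \<open>The path through agent 0 exists whatever agents 1 and 2 do. That it avoids their
  charging edges is what refutes the admissibility of their deviations.\<close>

lemma path_game_unit_flow:
  assumes "s 0 1 = 1" "s 0 2 = -1"
  obtains f where "flow path_game s f" "flow_value path_game f = 1"
    "f (Grid 1 1, Battery 1 1) = 0" "f (Grid 2 1, Battery 2 1) = 0"
proof
  let ?P = "{(Source, Grid 0 1), (Grid 0 1, Battery 0 1), (Battery 0 1, Battery 0 2),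
    (Battery 0 2, Grid 0 2), (Grid 0 2, Target)}"
  let ?f = "\<lambda>e. of_bool (e \<in> ?P) :: real"
  show "flow path_game s ?f"
    using battery_game_path_game
  proof (rule flow_of_bool)
    show "1 \<le> cap path_game s e" if "e \<in> ?P" for e
      using that assms by auto
  qed (unfold conservation_path_game, simp)
  show "flow_value path_game ?f = 1"
    unfolding flow_value_path_game by simp
qed simp_all

lemma path_game_double_flow:
  assumes "s 1 1 = 1" "s 1 2 = -1" "s 2 1 = 1" "s 2 2 = -1"
  obtains f where "flow path_game s f" "flow_value path_game f = 2"
proof
  \<comment> \<open>Two disjoint paths: supply 0 to demand 1 through agent 1, and supply 2 to demand
    0 through agent 2.\<close>
  let ?P = "{(Source, Grid 0 1), (Grid 0 1, Grid 1 1), (Grid 1 1, Battery 1 1),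
    (Battery 1 1, Battery 1 2), (Battery 1 2, Grid 1 2), (Grid 1 2, Target),
    (Source, Grid 2 1), (Grid 2 1, Battery 2 1), (Battery 2 1, Battery 2 2),
    (Battery 2 2, Grid 2 2), (Grid 2 2, Grid 0 2), (Grid 0 2, Target)}"
  let ?f = "\<lambda>e. of_bool (e \<in> ?P) :: real"
  show "flow path_game s ?f"
    using battery_game_path_game
  proof (rule flow_of_bool)
    show "1 \<le> cap path_game s e" if "e \<in> ?P" for e
      using that assms by auto
  qed (unfold conservation_path_game, simp)
  show "flow_value path_game ?f = 2"
    unfolding flow_value_path_game by simp
qed

lemma welfare_OPT_path_game: "welfare path_game (OPT path_game) = 2"
proof -
  \<comment> \<open>The outer agents 1 and 2 trade one unit each, which meets the bound given by the
    total supply.\<close>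
  let ?s = "\<lambda>b t. if b = 0 then 0 else if t = 1 then 1 else -1 :: real"
  obtain f where "flow path_game ?s f" "flow_value path_game f = 2"
    by (rule path_game_double_flow[of ?s]) auto
  then have "max_flow path_game ?s f"
    using flow_path_game_le_2 by (auto simp: max_flow_def)
  with \<open>flow_value path_game f = 2\<close> have two: "welfare path_game ?s = 2"
    by (simp add: welfare_eq)
  moreover have "welfare path_game s \<le> 2" for s
    using battery_game_path_game flow_path_game_le_2 by (rule welfare_le)
  moreover have "strategy_profile path_game ?s"
    by (simp add: strategy_profile_def strategy_two_periods)
  ultimately have "optimal_profile path_game ?s"
    by (simp add: optimal_profile_def)
  from welfare_OPT[OF this] two show ?thesis
    by simp
qed

section \<open>Bad equilibria and their welfare\<close>

text \<open>No strategy starts by discharging, so when the price does not rise, no admissible trade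
  yields a profit.\<close>

lemma nash_equilibrium_zero_path_game:
  assumes "p 2 \<le> p 1"
  shows "nash_equilibrium path_game p (\<lambda>_ _. 0)"
proof (rule nash_equilibrium_two_periods)
  show "\<sigma> 1 * (p 2 - p 1) \<le> 0 * (p 2 - p 1)" if "strategy path_game b \<sigma>" for b \<sigma>
    using that assms by (simp add: strategy_two_periods mult_nonneg_nonpos)
qed (simp_all add: battery_game_path_game strategy_profile_def strategy_two_periods admissible_zero)

lemma welfare_zero_path_game: "welfare path_game (\<lambda>_ _. 0) = 0"
proof -
  have "flow path_game (\<lambda>_ _. 0) (\<lambda>_. 0)"
    using cap_nonneg[OF battery_game_path_game] by (simp add: flow_def)
  moreover have "flow_value path_game (\<lambda>_. 0) = 0"
    by (simp add: flow_value_def)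
  ultimately show ?thesis
    using flow_path_game_le_0 welfare_eq[of path_game _ "\<lambda>_. 0"] by (simp add: max_flow_def)
qed

text \<open>Agent 0, the middle edge of the path, uses up supply 0 and demand 0, hence one end of
  the trade of each outer agent.\<close>

definition blocking_profile :: "nat profile" where
  "blocking_profile b t = (if b = 0 then if t = 1 then 1 else -1 else 0)"

text \<open>Stated for a general \<open>s\<close> so that it applies to
  \<open>blocking_profile\<close> and to every deviation of agent 1 or agent 2 from it.\<close>

lemma max_flow_blocking_value:
  assumes "s 0 = blocking_profile 0" "s 1 2 = 0 \<or> s 2 1 = 0"
  obtains f where "max_flow path_game s f" "flow_value path_game f = 1"
    "f (Grid 1 1, Battery 1 1) = 0" "f (Grid 2 1, Battery 2 1) = 0"
proof (rule path_game_unit_flow)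
  show "s 0 1 = 1" "s 0 2 = -1"
    using assms(1) by (simp_all add: blocking_profile_def)
next
  fix f
  assume f: "flow path_game s f" "flow_value path_game f = 1"
    "f (Grid 1 1, Battery 1 1) = 0" "f (Grid 2 1, Battery 2 1) = 0"
  moreover have "max_flow path_game s f"
    using f flow_path_game_le_1[OF _ assms(2)] by (simp add: max_flow_def)
  ultimately show ?thesis
    using that by blast
qed

lemma welfare_blocking: "welfare path_game blocking_profile = 1"
  by (rule max_flow_blocking_value[of blocking_profile])
    (simp_all add: blocking_profile_def welfare_eq)

lemma admissible_blocking:
  assumes "b \<in> agents path_game"
  shows "admissible path_game blocking_profile b"
proof (cases "b = 0")
  case True
  have "f e = cap path_game blocking_profile e"
    if f: "max_flow path_game blocking_profile f" and e: "e \<in> transaction_edges path_game 0" for f e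
  proof -
    have "flow path_game blocking_profile f" "1 \<le> flow_value path_game f"
      using f welfare_eq[OF f] by (simp_all add: max_flow_def welfare_blocking)
    note sat = flow_path_game_saturated[OF this]
    have "{1..2::nat} = {1, 2}"
      by auto
    with e have "e \<in> {(Grid 0 1, Battery 0 1), (Battery 0 1, Grid 0 1),
        (Grid 0 2, Battery 0 2), (Battery 0 2, Grid 0 2)}"
      by (simp add: transaction_edges_def charge_edge_def discharge_edge_def)
    with sat show ?thesis
      by (auto simp: blocking_profile_def)
  qed
  with True show ?thesis
    by (simp add: admissible_def admissible_edge_def)
next
  case False
  with assms show ?thesis
    by (intro admissible_zero) (simp_all add: blocking_profile_def)
qed

lemma nash_equilibrium_blocking:
  assumes "p 1 \<le> p 2"
  shows "nash_equilibrium path_game p blocking_profile"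
proof (rule nash_equilibrium_two_periods)
  fix b \<sigma>
  assume b: "b \<in> agents path_game" and \<sigma>: "strategy path_game b \<sigma>"
    and adm: "admissible path_game (blocking_profile(b := \<sigma>)) b"
  \<comment> \<open>As the price does not fall, it suffices that no admissible deviation charges
    more at time 1. For agent 0 the storage capacity 1 ensures this.\<close>
  have "\<sigma> 1 \<le> blocking_profile b 1"
  proof (cases "b = 0")
    case True
    with \<sigma> show ?thesis
      by (simp add: strategy_two_periods blocking_profile_def)
  next
    case False
    let ?s = "blocking_profile(b := \<sigma>)"
    \<comment> \<open>Some maximum flow bypasses agent \<open>b\<close>; admissibility demands that
      it saturate the charging edge, which forces the charge to be 0.\<close>
    obtain f where f: "max_flow path_game ?s f" "f (Grid b 1, Battery b 1) = 0"
      using False b by (auto intro: max_flow_blocking_value[of ?s] simp: blocking_profile_def)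
    have "charge_edge path_game b 1 \<in> transaction_edges path_game b"
      by (auto simp: transaction_edges_def)
    with f adm have "max 0 (\<sigma> 1) = 0"
      by (auto simp: admissible_def admissible_edge_def charge_edge_def)
    with False show ?thesis
      by (simp add: blocking_profile_def max_def split: if_splits)
  qed
  with assms show "\<sigma> 1 * (p 2 - p 1) \<le> blocking_profile b 1 * (p 2 - p 1)"
    by (intro mult_right_mono) auto
qed (auto simp: battery_game_path_game strategy_profile_def strategy_two_periods
    admissible_blocking blocking_profile_def)

theorem theorem4:
  fixes p :: prices
  shows "PoA 2 {p} \<ge> 2"
proof (cases "p 1 \<le> p 2")
  case True
  show ?thesis
    by (rule PoA_singleton_ge[OF battery_game_path_game _ nash_equilibrium_blocking[OF True]])
      (simp_all add: welfare_ratio_def welfare_OPT_path_game welfare_blocking)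
next
  case False
  then have "p 2 \<le> p 1"
    by simp
  \<comment> \<open>The equilibrium has welfare 0, so the ratio is \<infinity> by the convention for
    division by 0.\<close>
  show ?thesis
    by (rule PoA_singleton_ge[OF battery_game_path_game _
          nash_equilibrium_zero_path_game[OF \<open>p 2 \<le> p 1\<close>]])
      (simp_all add: welfare_ratio_def welfare_OPT_path_game welfare_zero_path_game)
qed

end
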